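(* Let $m,q,k\ge 1$, let $d$ be a positive divisor of $m$, and let $s$ be a linear sequence with $(s)\in\mathcal{C}^{(d)}(m,q,k)$. Then $\mathrm{BWT}(s)$ has the form $a_1^{\,d}a_2^{\,d}\cdots a_r^{\,d}$ where $a_1a_2\cdots a_r\in(\mathcal{P}_{m/d,q})^{q^{k-1}}\cap\mathcal{N}$.
   Context: Let $\Omega=\{0,1,\ldots,q-1\}$ with the usual order; a $k$-mer is an element of $\Omega^k$. For $s=a_1\ldots a_n$, $\rho(a_1\ldots a_n)=a_na_1\ldots a_{n-1}$; the cyclic sequence $(s)$ is the set of rotations of $s$. The number of occurrences of a $k$-mer $y$ in $(a_1\ldots a_n)$ is the number of $i\in\{1,\ldots,n\}$ with $a_i\cdots a_{i+k-1}=y$, indices modulo $n$ (positions may be reused if $k>n$). A cyclic multi de Bruijn sequence with parameters $(m,q,k)$ is a cyclic sequence over $\Omega$ in which every $k$-mer occurs exactly $m$ times. The order of $(s)$, $|s|=n$, is the largest positive divisor $d$ of $n$ with $\rho^{n/d}(s)=s$; $\mathcal{C}^{(d)}(m,q,k)$ is the set of cyclic multi de Bruijn sequences with parameters $(m,q,k)$ of order $d$. Burrows–Wheeler Transform: for $s\in\Omega^n$, sort the $n$ rotations $\rho^0(s),\ldots,\rho^{n-1}(s)$ (with repetitions) lexicographically as rows of an $n\times n$ table; $\mathrm{BWT}(s)$ is the last column read top to bottom. $a^d$ for a letter $a$ is $d$ copies of $a$. $\mathcal{P}_{m',q}$ is the set of words of length $m'q$ over $\Omega$ in which each symbol occurs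 exactly $m'$ times; $(\mathcal{P}_{m',q})^{q^{k-1}}$ is the set of concatenations of $q^{k-1}$ words from $\mathcal{P}_{m',q}$. $\mathcal{N}$ is the set of nonempty words $w$ over $\Omega$ that are not of the form $b_1^{\,i}b_2^{\,i}\cdots b_j^{\,i}$ (letters $b_1,\ldots,b_j$) for any $i>1$. *)

theory Defs
  imports Main "HOL-Library.List_Lexorder"
begin

definition alphabet :: "nat \<Rightarrow> nat set" where
  "alphabet q = {0..<q}"

definition kmers :: "nat \<Rightarrow> nat \<Rightarrow> nat list set" where
  "kmers q k = {y. set y \<subseteq> alphabet q \<and> length y = k}"

(* Rotation to the right: the last letter moves to the front (the library's rotate1 goes left). *)
definition rho :: "'a list \<Rightarrow> 'a list" where
  "rho s = (if s = [] then [] else last s # butlast s)"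

definition cyclic_seq :: "'a list \<Rightarrow> 'a list set" where
  "cyclic_seq s = {(rho ^^ i) s | i. True}"

(* Number of cyclic occurrences of y in s. It depends only on the rotation class of s. *)
definition occurrences :: "'a list \<Rightarrow> 'a list \<Rightarrow> nat" where
  "occurrences y s =
     card {i. i < length s \<and> map (\<lambda>j. s ! ((i + j) mod length s)) [0..<length y] = y}"

(* For nonempty s; the set is finite and contains 1. It depends only on the rotation class of s. *)
definition cyclic_order :: "'a list \<Rightarrow> nat" where
  "cyclic_order s =
     Max {d. 0 < d \<and> d dvd length s \<and> (rho ^^ (length s div d)) s = s}"

definition multi_de_bruijn :: "nat \<Rightarrow> nat \<Rightarrow> nat \<Rightarrow> nat list set set" where
  "multi_de_bruijn m q k =
     {cyclic_seq s | s. set s \<subseteq> alphabet q \<and> (\<forall>y\<in>kmers q k. occurrences y s = m)}"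

definition multi_de_bruijn_of_order :: "nat \<Rightarrow> nat \<Rightarrow> nat \<Rightarrow> nat \<Rightarrow> nat list set set" where
  "multi_de_bruijn_of_order d m q k =
     {cyclic_seq s | s. cyclic_seq s \<in> multi_de_bruijn m q k \<and> cyclic_order s = d}"

(* The order on lists used by sort is the lexicographic one from List_Lexorder. *)
definition bwt :: "nat list \<Rightarrow> nat list" where
  "bwt s = map last (sort (map (\<lambda>i. (rho ^^ i) s) [0..<length s]))"

(* letter_power d (a1 ... ar) is the word a1^d ... ar^d. *)
definition letter_power :: "nat \<Rightarrow> 'a list \<Rightarrow> 'a list" where
  "letter_power d w = concat (map (replicate d) w)"

definition balanced_words :: "nat \<Rightarrow> nat \<Rightarrow> nat list set" where
  "balanced_words m q =
     {w. set w \<subseteq> alphabet q \<and> length w = m * q \<and> (\<forall>a\<in>alphabet q. count_list w a = m)}"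

definition concat_power :: "'a list set \<Rightarrow> nat \<Rightarrow> 'a list set" where
  "concat_power L t = {concat ws | ws. length ws = t \<and> set ws \<subseteq> L}"

definition non_letter_powers :: "nat \<Rightarrow> nat list set" where
  "non_letter_powers q =
     {w. w \<noteq> [] \<and> set w \<subseteq> alphabet q \<and>
         \<not> (\<exists>i>1. \<exists>b. set b \<subseteq> alphabet q \<and> w = letter_power i b)}"

end

theory Submission
  imports Defs "HOL-Library.Multiset"
begin

text \<open>
  The sorted table of rotations contains every row exactly \<open>d\<close> times, where \<open>d\<close> is the order, so
  it is a letter power with exponent \<open>d\<close>, and hence so is its last column. Rows with a common
  prefix \<open>x\<close> of length \<open>k - 1\<close> are consecutive, and rotating such a row that ends in \<open>c\<close> yields a
  row starting with the \<open>k\<close>-mer \<open>c x\<close>; thus each letter \<open>c\<close> ends exactly \<open>m\<close> of them, which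
  gives the balanced blocks.

  If the reduced word were a letter power with exponent \<open>i > 1\<close>, then the Burrows--Wheeler
  transform would be one with exponent \<open>D = d i\<close>. The transform determines the table: the sorted
  list of prefixes of length \<open>l + 1\<close> is obtained by prepending the transform letterwise to the
  sorted list of prefixes of length \<open>l\<close> and sorting again. Each of these steps preserves letter
  powers with exponent \<open>D\<close>, so every row would occur a multiple of \<open>D > d\<close> times.
\<close>

subsection \<open>Letter powers\<close>

lemma letter_power_Nil [simp]: "letter_power d [] = []"
  and letter_power_Cons [simp]: "letter_power d (x # xs) = replicate d x @ letter_power d xs"
  and letter_power_append [simp]:
    "letter_power d (xs @ ys) = letter_power d xs @ letter_power d ys"
  by (simp_all add: letter_power_def)

lemma letter_power_replicate: "letter_power d (replicate n x) = replicate (d * n) x"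
  by (induction n) (simp_all add: replicate_add)

lemma length_letter_power [simp]: "length (letter_power d xs) = d * length xs"
  by (induction xs) simp_all

lemma set_letter_power: "0 < d \<Longrightarrow> set (letter_power d xs) = set xs"
  by (induction xs) simp_all

lemma letter_power_letter_power:
  "letter_power d (letter_power i xs) = letter_power (d * i) xs"
  by (induction xs) (simp_all add: letter_power_replicate)

lemma map_letter_power: "map f (letter_power d xs) = letter_power d (map f xs)"
  by (induction xs) simp_all

lemma filter_letter_power: "filter P (letter_power d xs) = letter_power d (filter P xs)"
  by (induction xs) simp_all

lemma count_mset_letter_power:
  "count (mset (letter_power d xs)) x = d * count (mset xs) x"
  by (induction xs) simp_all

lemma map2_letter_power:
  "length xs = length ys \<Longrightarrow>
    map2 f (letter_power d xs) (letter_power d ys) = letter_power d (map2 f xs ys)"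
  by (induction xs ys rule: list_induct2) simp_all

lemma sorted_letter_power:
  fixes xs :: "'a::linorder list"
  shows "sorted xs \<Longrightarrow> sorted (letter_power d xs)"
  by (cases "d = 0") (induction xs; auto simp: sorted_append set_letter_power letter_power_def)+

lemma sort_letter_power:
  fixes xs :: "'a::linorder list"
  shows "sort (letter_power d xs) = letter_power d (sort xs)"
  by (rule properties_for_sort)
     (auto simp: sorted_letter_power multiset_eq_iff count_mset_letter_power)

text \<open>A sorted list is determined by its multiset, and both sides contain each element of
  \<open>set xs\<close> exactly \<open>d\<close> times.\<close>

lemma sorted_eq_letter_power:
  fixes xs :: "'a::linorder list"
  assumes "sorted xs" and "\<And>x. x \<in> set xs \<Longrightarrow> count (mset xs) x = d"
  shows "xs = letter_power d (sorted_list_of_set (set xs))"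
proof -
  have "mset (letter_power d (sorted_list_of_set (set xs))) = mset xs"
  proof (rule multiset_eqI)
    fix x
    show "count (mset (letter_power d (sorted_list_of_set (set xs)))) x = count (mset xs) x"
      using assms(2)[of x] count_mset_0_iff[of xs x]
        distinct_count_atmost_1[of "sorted_list_of_set (set xs)"]
      by (cases "x \<in> set xs") (auto simp: count_mset_letter_power simp del: count_mset_0_iff)
  qed
  then have "sort xs = letter_power d (sorted_list_of_set (set xs))"
    by (intro properties_for_sort sorted_letter_power) simp_all
  then show ?thesis
    using assms(1) by (simp add: sorted_sort_id)
qed

lemma count_mset_map_filter:
  "count (mset (map f (filter P xs))) c = size {#r \<in># mset xs. f r = c \<and> P r#}"
  by (induction xs) auto

subsection \<open>Rotations\<close>

definition rotations :: "'a list \<Rightarrow> 'a list list" where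
  "rotations s = map (\<lambda>i. (rho ^^ i) s) [0..<length s]"

lemma rho_rotate1 [simp]: "rho (rotate1 s) = s"
  by (cases s) (simp_all add: rho_def)

lemma rotate1_rho [simp]: "rotate1 (rho s) = s"
  by (simp add: rho_def)

lemma length_rho [simp]: "length (rho s) = length s"
  by (simp add: rho_def)

lemma length_rho_funpow [simp]: "length ((rho ^^ i) s) = length s"
  by (induction i) simp_all

lemma set_rho [simp]: "set (rho s) = set s"
  by (metis rotate1_rho set_rotate1)

lemma set_rho_funpow [simp]: "set ((rho ^^ i) s) = set s"
  by (induction i) simp_all

lemma inj_rho_funpow: "inj (rho ^^ i)"
  by (intro inj_fn) (metis injI rotate1_rho)

lemma rho_funpow_rotate: "(rho ^^ i) (rotate i s) = s"
  by (induction i arbitrary: s) (simp_all add: funpow_swap1)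

lemma rho_funpow_length [simp]: "(rho ^^ length s) s = s"
  using rho_funpow_rotate[of "length s" s] by simp

lemma length_rotations [simp]: "length (rotations s) = length s"
  by (simp add: rotations_def)

lemma length_of_rotation: "r \<in> set (rotations s) \<Longrightarrow> length r = length s"
  by (auto simp: rotations_def)

lemma rotation_nonempty: "r \<in> set (rotations s) \<Longrightarrow> r \<noteq> []"
  using length_of_rotation[of r s] by (cases s) (auto simp: rotations_def)

text \<open>Applying \<open>rho\<close> shifts the exponents from 0, ..., n-1 to 1, ..., n, and
  exponent n gives \<open>s\<close> again, so the rows are only permuted.\<close>

lemma mset_map_rho_rotations: "mset (map rho (rotations s)) = mset (rotations s)"
proof (cases s)
  case (Cons x xs)
  define f where "f = (\<lambda>i. (rho ^^ i) s)"
  have "map rho (rotations s) = map f [1..<Suc (length s)]"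
    by (simp add: rotations_def f_def map_Suc_upt[symmetric] del: upt_Suc)
  also have "\<dots> = map f [1..<length s] @ [f (length s)]"
    using Cons by simp
  also have "f (length s) = f 0"
    by (simp add: f_def)
  also have "mset (map f [1..<length s] @ [f 0]) = mset (f 0 # map f [1..<length s])"
    by simp
  also have "f 0 # map f [1..<length s] = map f [0..<length s]"
    using Cons by (simp add: upt_conv_Cons del: upt_Suc)
  finally show ?thesis
    by (simp add: rotations_def f_def)
qed (simp add: rotations_def)

lemma map_rho_rotations: "map rho (rotations s) = rotations (rho s)"
  by (simp add: rotations_def funpow_swap1)

lemma mset_rotations_cyclic_seq:
  "r \<in> cyclic_seq s \<Longrightarrow> mset (rotations r) = mset (rotations s)"
proof -
  have "mset (rotations ((rho ^^ i) s)) = mset (rotations s)" for i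
    by (induction i) (simp_all flip: map_rho_rotations add: mset_map_rho_rotations del: mset_map)
  then show "r \<in> cyclic_seq s \<Longrightarrow> mset (rotations r) = mset (rotations s)"
    by (auto simp: cyclic_seq_def)
qed

lemma self_in_cyclic_seq: "s \<in> cyclic_seq s"
  unfolding cyclic_seq_def by (auto intro: exI[of _ 0])

text \<open>Occurrences are read off left rotations, whereas the table consists of right rotations;
  this lemma links the two.\<close>

lemma mset_rotations_rotate:
  "mset (rotations s) = mset (map (\<lambda>i. rotate i s) [0..<length s])"
proof -
  \<comment> \<open>Starting from \<open>rho s\<close> makes the exponents run over 1, ..., n, so
    that after reversal entry i is the right rotation by n-i, which is the left rotation by
    i.\<close>
  have "rev (rotations (rho s)) = map (\<lambda>i. rotate i s) [0..<length s]"
  proof (rule nth_equalityI)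
    fix i assume "i < length (rev (rotations (rho s)))"
    then have i: "i < length s" "length s - Suc i < length s" by simp_all
    have "(rho ^^ (length s - Suc i)) (rho s) = (rho ^^ (length s - i)) s"
      using i by (metis Suc_diff_Suc comp_apply funpow.simps(2) funpow_swap1)
    also have "\<dots> = (rho ^^ (length s - i)) ((rho ^^ i) (rotate i s))"
      by (simp add: rho_funpow_rotate)
    also have "\<dots> = (rho ^^ length (rotate i s)) (rotate i s)"
      using i by (metis add.commute comp_apply funpow_add le_add_diff_inverse length_rotate
          less_imp_le)
    finally show "rev (rotations (rho s)) ! i = map (\<lambda>i. rotate i s) [0..<length s] ! i"
      using i rho_funpow_length[of "rotate i s"] by (simp add: rev_nth rotations_def)
  qed simp
  then show ?thesis
    by (metis mset_map_rho_rotations map_rho_rotations mset_rev)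
qed

lemma count_rotations_self:
  assumes "s \<noteq> []"
  shows "count (mset (rotations s)) s = cyclic_order s"
proof -
  define n where "n = length s"
  define p where "p = (LEAST p. 0 < p \<and> (rho ^^ p) s = s)"
  have n: "0 < n" "(rho ^^ n) s = s"
    using assms by (simp_all add: n_def)
  have p: "0 < p" "(rho ^^ p) s = s"
    using LeastI[of "\<lambda>p. 0 < p \<and> (rho ^^ p) s = s" n] n by (simp_all add: p_def)
  have least: "p \<le> j" if "0 < j" "(rho ^^ j) s = s" for j
    using that by (auto simp: p_def intro: Least_le)
  \<comment> \<open>Only \<open>j mod p\<close> matters, and a nonzero remainder fixing
    \<open>s\<close> would contradict the minimality of \<open>p\<close>.\<close>
  have fix_iff: "(rho ^^ j) s = s \<longleftrightarrow> p dvd j" for j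
  proof -
    have "(rho ^^ j) s = (rho ^^ (j mod p)) s"
      using p by (metis funpow_mod_eq)
    moreover have "(rho ^^ (j mod p)) s = s \<longleftrightarrow> j mod p = 0"
      using least[of "j mod p"] p(1) mod_less_divisor[of p j] by fastforce
    ultimately show ?thesis by (simp add: dvd_eq_mod_eq_0)
  qed
  then obtain e where e: "n = p * e" using n by auto
  have e0: "0 < e" using e n by auto
  have "{i. i < n \<and> s = (rho ^^ i) s} = (\<lambda>j. p * j) ` {..<e}"
    using p(1) by (auto simp: eq_commute[of s] fix_iff e)
  then have "count (mset (rotations s)) s = card ((\<lambda>j. p * j) ` {..<e})"
    by (simp add: rotations_def count_mset count_list_eq_length_filter length_filter_conv_card
        filter_map o_def n_def cong: conj_cong del: mset_map)
  also have "\<dots> = e"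
    using p(1) by (simp add: card_image inj_on_def)
  also have "e = cyclic_order s"
    unfolding cyclic_order_def n_def[symmetric]
  proof (rule Max_eqI[symmetric])
    show "finite {d. 0 < d \<and> d dvd n \<and> (rho ^^ (n div d)) s = s}"
      using n by simp
    show "e \<in> {d. 0 < d \<and> d dvd n \<and> (rho ^^ (n div d)) s = s}"
      using e e0 p by simp
  next
    fix d assume "d \<in> {d. 0 < d \<and> d dvd n \<and> (rho ^^ (n div d)) s = s}"
    then have "0 < d" "d dvd n" "p dvd n div d" by (auto simp: fix_iff)
    then have "d * p dvd e * p"
      using e by (metis dvd_mult_div_cancel mult.commute mult_dvd_mono dvd_refl)
    then show "d \<le> e"
      using p(1) e0 by (auto dest: dvd_imp_le)
  qed
  finally show ?thesis .
qed

text \<open>Powers of \<open>rho\<close> commute and are injective, so the same exponents fix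
  \<open>r\<close> and \<open>s\<close>.\<close>

lemma cyclic_order_cyclic_seq:
  "r \<in> cyclic_seq s \<Longrightarrow> cyclic_order r = cyclic_order s"
proof -
  have "(rho ^^ j) ((rho ^^ i) s) = (rho ^^ i) ((rho ^^ j) s)" for i j
    by (metis add.commute comp_apply funpow_add)
  then have "(rho ^^ j) ((rho ^^ i) s) = (rho ^^ i) s \<longleftrightarrow> (rho ^^ j) s = s" for i j
    by (simp add: inj_eq[OF inj_rho_funpow])
  then show "r \<in> cyclic_seq s \<Longrightarrow> cyclic_order r = cyclic_order s"
    by (auto simp: cyclic_seq_def cyclic_order_def)
qed

lemma count_rotations:
  assumes "r \<in> set (rotations s)"
  shows "count (mset (rotations s)) r = cyclic_order s"
proof -
  have "r \<in> cyclic_seq s"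
    using assms by (auto simp: rotations_def cyclic_seq_def)
  then show ?thesis
    using rotation_nonempty[OF assms]
    by (metis count_rotations_self cyclic_order_cyclic_seq mset_rotations_cyclic_seq)
qed

subsection \<open>Cyclic prefixes\<close>

text \<open>The prefix of length \<open>l\<close> of the periodic infinite word \<open>s s s \<dots>\<close>; for
  \<open>q = 1\<close> the length of a \<open>k\<close>-mer may exceed that of \<open>s\<close>, so \<open>take\<close> does not suffice.\<close>
definition cyclic_prefix :: "nat \<Rightarrow> 'a list \<Rightarrow> 'a list" where
  "cyclic_prefix l s = map (\<lambda>j. s ! (j mod length s)) [0..<l]"

lemma length_cyclic_prefix [simp]: "length (cyclic_prefix l s) = l"
  by (simp add: cyclic_prefix_def)

lemma cyclic_prefix_0 [simp]: "cyclic_prefix 0 s = []"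
  by (simp add: cyclic_prefix_def)

lemma set_cyclic_prefix: "s \<noteq> [] \<Longrightarrow> set (cyclic_prefix l s) \<subseteq> set s"
  by (auto simp: cyclic_prefix_def)

lemma cyclic_prefix_length: "cyclic_prefix (length s) s = s"
  by (rule nth_equalityI) (simp_all add: cyclic_prefix_def)

lemma cyclic_prefix_rho:
  assumes "s \<noteq> []"
  shows "cyclic_prefix (Suc l) (rho s) = last s # cyclic_prefix l s"
proof (rule nth_equalityI)
  fix j assume "j < length (cyclic_prefix (Suc l) (rho s))"
  then have j: "j < Suc l" by simp
  show "cyclic_prefix (Suc l) (rho s) ! j = (last s # cyclic_prefix l s) ! j"
  proof (cases j)
    case (Suc i)
    \<comment> \<open>Either position i reads the last letter of \<open>s\<close>, so that i+1 wraps
      around to the front of \<open>rho s\<close>, or it reads a letter of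
      \<open>butlast s\<close>.\<close>
    have "i mod length s < length s" using assms by simp
    then consider "i mod length s = length s - 1" | "i mod length s < length (butlast s)"
      by fastforce
    then show ?thesis
    proof cases
      case 1
      then show ?thesis
        using Suc j assms
        by (simp add: cyclic_prefix_def rho_def mod_Suc last_conv_nth del: upt_Suc)
    next
      case 2
      then have "Suc (i mod length s) \<noteq> length s" by auto
      then show ?thesis
        using Suc j assms nth_butlast[OF 2]
        by (simp add: cyclic_prefix_def rho_def mod_Suc del: upt_Suc)
    qed
  qed (use assms in \<open>simp add: cyclic_prefix_def rho_def del: upt_Suc\<close>)
qed simp

text \<open>The first difference of \<open>r\<close> and \<open>s\<close> stays the first difference
  of their periodic extensions, unless the prefixes end before it and coincide.\<close>

lemma cyclic_prefix_mono:
  fixes r s :: "'a::linorder list"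
  assumes "length r = length s" and "r \<le> s"
  shows "cyclic_prefix l r \<le> cyclic_prefix l s"
proof (cases "r = s")
  case False
  with assms have "(r, s) \<in> lexord {(u, v). u < v}"
    by (auto simp: list_le_def list_less_def)
  then obtain i where i: "i < length s" "take i r = take i s" "r ! i < s ! i"
    using assms(1) by (auto simp: lexord_take_index_conv)
  have eq: "r ! j = s ! j" if "j < i" for j
    using i(2) that by (metis nth_take)
  show ?thesis
  proof (cases "l \<le> i")
    case True
    then have "cyclic_prefix l r = cyclic_prefix l s"
      using i(1) assms(1) by (auto simp: cyclic_prefix_def eq)
    then show ?thesis by simp
  next
    case False
    have "take i (cyclic_prefix l r) = take i (cyclic_prefix l s)"
      using i(1) assms(1) False by (auto simp: cyclic_prefix_def take_map eq)
    then have "(cyclic_prefix l r, cyclic_prefix l s) \<in> lexord {(u, v). u < v}"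
      using i assms(1) False
      by (auto simp: lexord_take_index_conv cyclic_prefix_def intro!: exI[of _ i])
    then show ?thesis
      by (simp add: list_le_def list_less_def)
  qed
qed simp

text \<open>The window at position i is the cyclic prefix of the left rotation by i. The right side
  depends only on the multiset of rows, hence only on the rotation class.\<close>

lemma occurrences_eq_count_rotations:
  "occurrences y s = size {#r \<in># mset (rotations s). cyclic_prefix (length y) r = y#}"
proof -
  have pre: "cyclic_prefix l (rotate i s) = map (\<lambda>j. s ! ((i + j) mod length s)) [0..<l]"
    if "i < length s" for i l
  proof -
    have "0 < length s" using that by linarith
    then show ?thesis
      by (auto simp: cyclic_prefix_def nth_rotate mod_add_right_eq)
  qed
  show ?thesis
    by (simp add: occurrences_def mset_rotations_rotate length_filter_conv_card
        pre filter_map o_def cong: conj_cong flip: mset_filter del: mset_map)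
qed

subsection \<open>The sorted table of rotations\<close>

text \<open>Sorted keys make equal keys consecutive, so the list falls into runs, one for each key
  and possibly empty; the induction peels off the run of the smallest key.\<close>

lemma concat_filter_keys:
  fixes f :: "'a \<Rightarrow> 'b::linorder"
  assumes "sorted (map f xs)" and "sorted ks" and "distinct ks" and "f ` set xs \<subseteq> set ks"
  shows "concat (map (\<lambda>x. filter (\<lambda>r. f r = x) xs) ks) = xs"
  using assms
proof (induction ks arbitrary: xs)
  case (Cons k ks)
  have split: "filter (\<lambda>r. f r = k) xs @ filter (\<lambda>r. f r \<noteq> k) xs = xs"
    if "sorted (map f xs)" "\<forall>r\<in>set xs. k \<le> f r" for xs
    using that
  proof (induction xs)
    case (Cons r xs)
    show ?case
    proof (cases "f r = k")
      case False
      with Cons.prems have "\<forall>r'\<in>set (r # xs). f r' \<noteq> k" by fastforce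
      then show ?thesis by (simp add: filter_id_conv filter_empty_conv)
    qed (use Cons in simp)
  qed simp
  have min: "\<forall>r\<in>set xs. k \<le> f r"
    using Cons.prems by auto
  let ?ys = "filter (\<lambda>r. f r \<noteq> k) xs"
  have "concat (map (\<lambda>x. filter (\<lambda>r. f r = x) ?ys) ks) = ?ys"
    using Cons.prems by (intro Cons.IH) (auto intro: sorted_filter)
  moreover have "map (\<lambda>x. filter (\<lambda>r. f r = x) ?ys) ks = map (\<lambda>x. filter (\<lambda>r. f r = x) xs) ks"
    using Cons.prems(3) by (auto intro!: filter_cong)
  ultimately have "concat (map (\<lambda>x. filter (\<lambda>r. f r = x) xs) ks) = ?ys"
    by (simp only:)
  then show ?case
    using split[OF Cons.prems(1) min] by (simp only: list.map concat.simps)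
qed simp

section \<open>The Burrows-Wheeler transform and its inversion\<close>

lemma bwt_eq: "bwt s = map last (sort (rotations s))"
  by (simp add: bwt_def rotations_def)

lemma sorted_map_cyclic_prefix:
  fixes xs :: "'a::linorder list list"
  assumes "sorted xs" and "\<And>r. r \<in> set xs \<Longrightarrow> length r = n"
  shows "sorted (map (cyclic_prefix l) xs)"
  using assms by (induction xs) (auto intro: cyclic_prefix_mono)

text \<open>One step of inverting the Burrows--Wheeler transform.\<close>
lemma cyclic_prefix_Suc_sort_rotations:
  "map (cyclic_prefix (Suc l)) (sort (rotations s)) =
    sort (map2 (#) (bwt s) (map (cyclic_prefix l) (sort (rotations s))))"
proof (rule properties_for_sort[symmetric])
  let ?T = "sort (rotations s)"
  have "map2 (#) (bwt s) (map (cyclic_prefix l) ?T) = map (\<lambda>r. last r # cyclic_prefix l r) ?T"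
    by (simp add: bwt_eq zip_map_map zip_same_conv_map)
  \<comment> \<open>The last letter of a row cyclically precedes its prefix; since
    \<open>rho\<close> permutes the rows, only the order has to be restored by sorting.\<close>
  also have "\<dots> = map (\<lambda>r. cyclic_prefix (Suc l) (rho r)) ?T"
    by (intro map_cong) (use rotation_nonempty[of _ s] cyclic_prefix_rho in \<open>fastforce\<close>)+
  also have "mset \<dots> = image_mset (cyclic_prefix (Suc l)) (mset (map rho (rotations s)))"
    by (simp add: image_mset.compositionality o_def)
  also have "\<dots> = mset (map (cyclic_prefix (Suc l)) ?T)"
    unfolding mset_map_rho_rotations by simp
  finally show "mset (map (cyclic_prefix (Suc l)) ?T) =
      mset (map2 (#) (bwt s) (map (cyclic_prefix l) ?T))" ..
  show "sorted (map (cyclic_prefix (Suc l)) ?T)"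
    by (rule sorted_map_cyclic_prefix[where n = "length s"]) (auto simp: length_of_rotation)
qed

lemma sort_rotations_eq_letter_power:
  assumes "bwt s = letter_power D b"
  shows "\<exists>u. sort (rotations s) = letter_power D u"
proof -
  let ?T = "sort (rotations s)"
  have len: "length s = D * length b"
    using arg_cong[OF assms, of length] by (simp add: bwt_eq)
  \<comment> \<open>The length of \<open>u\<close> is part of the invariant so that the zip with
    \<open>b\<close> matches letter by letter; at l = n the prefixes are the full rows.\<close>
  have "\<exists>u. length u = length b \<and> map (cyclic_prefix l) ?T = letter_power D u" for l
  proof (induction l)
    case 0
    have "map (cyclic_prefix 0) ?T = replicate (D * length b) []"
      by (intro replicate_eqI) (auto simp: len)
    then show ?case
      by (intro exI[of _ "replicate (length b) []"])
        (simp only: letter_power_replicate length_replicate)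
  next
    case (Suc l)
    then obtain u where u: "length u = length b" "map (cyclic_prefix l) ?T = letter_power D u"
      by auto
    then have "map (cyclic_prefix (Suc l)) ?T = letter_power D (sort (map2 (#) b u))"
      by (simp add: cyclic_prefix_Suc_sort_rotations assms map2_letter_power sort_letter_power)
    with u show ?case by (intro exI[of _ "sort (map2 (#) b u)"]) simp
  qed
  moreover have "map (cyclic_prefix (length s)) ?T = ?T"
    by (rule map_idI) (use length_of_rotation cyclic_prefix_length in \<open>metis set_sort\<close>)
  ultimately show ?thesis by metis
qed

section \<open>Balanced blocks and irreducibility of the reduced word\<close>

theorem theorem9:
  fixes m q k d :: nat and s :: "nat list"
  assumes "m \<ge> 1" and "q \<ge> 1" and "k \<ge> 1"
    and "d \<ge> 1" and "d dvd m"
    and "cyclic_seq s \<in> multi_de_bruijn_of_order d m q k"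
  shows "\<exists>a. bwt s = letter_power d a \<and>
             a \<in> concat_power (balanced_words (m div d) q) (q ^ (k - 1)) \<inter> non_letter_powers q"
proof -
  \<comment> \<open>The order and the k-mer counts are known for possibly different representatives
    of the class; both transfer to \<open>s\<close>.\<close>
  obtain s' s'' where s': "cyclic_seq s = cyclic_seq s'" "cyclic_order s' = d"
    and s'': "cyclic_seq s' = cyclic_seq s''" "set s'' \<subseteq> alphabet q"
      "\<forall>y\<in>kmers q k. occurrences y s'' = m"
    using assms(6) by (auto simp: multi_de_bruijn_of_order_def multi_de_bruijn_def)
  have mem: "s \<in> cyclic_seq s'" "s \<in> cyclic_seq s''"
    using self_in_cyclic_seq[of s] s'(1) s''(1) by auto
  have ord: "cyclic_order s = d"
    using cyclic_order_cyclic_seq[OF mem(1)] s'(2) by simp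
  have alph: "set s \<subseteq> alphabet q"
    using mem(2) s''(2) by (auto simp: cyclic_seq_def)
  have occ: "occurrences y s = m" if "y \<in> kmers q k" for y
    using that s''(3) mset_rotations_cyclic_seq[OF mem(2)]
    by (simp add: occurrences_eq_count_rotations)
  have "replicate k 0 \<in> kmers q k"
    using assms(2) by (auto simp: kmers_def alphabet_def)
  then have ne: "s \<noteq> []"
    using occ[of "replicate k 0"] assms(1) by (auto simp: occurrences_def)
  define T where "T = sort (rotations s)"
  \<comment> \<open>\<open>U\<close> keeps one copy of each row; its last letters form the witness
    for \<open>a\<close>.\<close>
  define U where "U = sorted_list_of_set (set T)"
  have TU: "T = letter_power d U"
    unfolding U_def by (rule sorted_eq_letter_power) (auto simp: T_def count_rotations ord)
  have bwt: "bwt s = letter_power d (map last U)"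
    by (simp add: bwt_eq map_letter_power TU flip: T_def)
  have row: "length r = length s" "set r = set s" if "r \<in> set U" for r
    using that by (auto simp: U_def T_def rotations_def)
  have row_ne: "r \<noteq> []" if "r \<in> set U" for r
    using row(1)[OF that] ne by auto
  have last_U: "set (map last U) \<subseteq> alphabet q"
  proof -
    have "last r \<in> alphabet q" if "r \<in> set U" for r
      using last_in_set[OF row_ne[OF that]] row(2)[OF that] alph by blast
    then show ?thesis by auto
  qed

  \<comment> \<open>One block is taken for each (k-1)-mer, in lexicographic order, which yields the
    exponent \<open>q ^ (k - 1)\<close>.\<close>
  define X where "X = sorted_list_of_set (kmers q (k - 1))"
  have kmers_eq: "kmers q l = {y. set y \<subseteq> {0..<q} \<and> length y = l}" for l
    by (auto simp: kmers_def alphabet_def)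
  have fin: "finite (kmers q (k - 1))"
    by (simp add: kmers_eq finite_lists_length_eq)
  have lenX: "length X = q ^ (k - 1)"
    by (simp add: X_def kmers_eq card_lists_length_eq)
  define block where "block x = map last (filter (\<lambda>r. cyclic_prefix (k - 1) r = x) U)" for x
  have U_blocks: "concat (map (\<lambda>x. filter (\<lambda>r. cyclic_prefix (k - 1) r = x) U) X) = U"
  proof (rule concat_filter_keys)
    show "sorted (map (cyclic_prefix (k - 1)) U)"
      by (rule sorted_map_cyclic_prefix[where n = "length s"])
         (auto simp: U_def row(1)[unfolded U_def])
    show "cyclic_prefix (k - 1) ` set U \<subseteq> set X"
    proof -
      have "set (cyclic_prefix (k - 1) r) \<subseteq> alphabet q" if "r \<in> set U" for r
        using set_cyclic_prefix[OF row_ne[OF that]] row(2)[OF that] alph by blast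
      then show ?thesis using fin by (auto simp: X_def kmers_def)
    qed
  qed (simp_all add: X_def)
  have "map last U = concat (map block X)"
    using arg_cong[OF U_blocks, of "map last"] by (simp add: map_concat block_def[abs_def] o_def)
  moreover have "block x \<in> balanced_words (m div d) q" if "x \<in> set X" for x
  proof -
    have x: "x \<in> kmers q (k - 1)" using that fin by (simp add: X_def)
    have sub: "set (block x) \<subseteq> alphabet q"
      using last_U by (auto simp: block_def)
    have cnt: "count_list (block x) c = m div d" if c: "c \<in> alphabet q" for c
    proof -
      have cx: "c # x \<in> kmers q k" "length (c # x) = k"
        using x c assms(3) by (auto simp: kmers_def)
      \<comment> \<open>The factor \<open>d\<close> passes from distinct rows to the full table,
        where the count becomes the number of occurrences of \<open>c # x\<close>, namely
        \<open>m\<close>.\<close>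
      have "d * count_list (block x) c = count (mset (letter_power d (block x))) c"
        by (simp add: count_mset_letter_power flip: count_mset)
      also have "letter_power d (block x) = map last (filter (\<lambda>r. cyclic_prefix (k - 1) r = x) T)"
        by (simp add: block_def TU map_letter_power filter_letter_power)
      also have "count (mset \<dots>) c =
          size {#r \<in># mset (rotations s). last r = c \<and> cyclic_prefix (k - 1) r = x#}"
        by (subst count_mset_map_filter) (simp add: T_def)
      also have "{#r \<in># mset (rotations s). last r = c \<and> cyclic_prefix (k - 1) r = x#} =
          {#r \<in># mset (rotations s). cyclic_prefix k (rho r) = c # x#}"
      proof (rule filter_mset_cong0)
        fix r assume "r \<in># mset (rotations s)"
        then have "r \<noteq> []" using rotation_nonempty[of r s] by simp
        then show "(last r = c \<and> cyclic_prefix (k - 1) r = x) =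
            (cyclic_prefix k (rho r) = c # x)"
          using cyclic_prefix_rho[of r "k - 1"] assms(3) by simp
      qed
      also have "size \<dots> = size {#r \<in># mset (map rho (rotations s)). cyclic_prefix k r = c # x#}"
        by (simp add: filter_mset_image_mset o_def)
      also have "\<dots> = m"
        using occ[OF cx(1)] cx(2)
        by (simp only: mset_map_rho_rotations occurrences_eq_count_rotations)
      finally show ?thesis using assms(4) by auto
    qed
    \<comment> \<open>The block length comes from summing the letter counts over the
      \<open>q\<close> letters.\<close>
    have "length (block x) = sum (count_list (block x)) (alphabet q)"
      using sub by (intro sum_count_set[symmetric]) (simp_all add: alphabet_def)
    with sub cnt show ?thesis
      by (simp add: balanced_words_def alphabet_def)
  qed
  ultimately have "map last U \<in> concat_power (balanced_words (m div d) q) (q ^ (k - 1))"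
    using lenX by (auto simp: concat_power_def intro!: exI[of _ "map block X"])
  moreover have "map last U \<in> non_letter_powers q"
  proof -
    have s_T: "s \<in> set T"
      using ne by (auto simp: T_def rotations_def image_iff intro!: bexI[of _ 0])
    have False if "i > 1" "map last U = letter_power i b" for i b
    proof -
      have "bwt s = letter_power (d * i) b"
        using bwt that by (simp add: letter_power_letter_power)
      then obtain u where "T = letter_power (d * i) u"
        using sort_rotations_eq_letter_power T_def by blast
      \<comment> \<open>The row \<open>s\<close> has multiplicity exactly \<open>d\<close> in the
        table, so cancelling \<open>d\<close> forces \<open>i\<close> to divide 1.\<close>
      then have "count (mset T) s = d * i * count (mset u) s"
        by (simp add: count_mset_letter_power)
      moreover have "count (mset T) s = d"
        using s_T by (simp add: T_def count_rotations ord)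
      ultimately have "i dvd 1" using assms(4) by (auto simp: mult.assoc)
      then show False using that by simp
    qed
    moreover have "map last U \<noteq> []" using s_T by (auto simp: U_def)
    ultimately show ?thesis using last_U by (auto simp: non_letter_powers_def)
  qed
  ultimately show ?thesis using bwt by blast
qed

end
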